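(* Let $F$ be a non-archimedean ordered field, $\mathcal{C}$ the set of all convex subgroups of $(F,+)$, and $Q=\{a+A: a\in F, A\in\mathcal{C}\}$ with operations $(a+A)+(b+B)=a+b+A+B$ and $(a+A)(b+B)=ab+aB+bA+AB$. Then $(Q,+,\cdot)$, with $e(a+A)=A$, $s(a+A)=-a+A$, and for zeroless $\alpha=a+A$ (i.e. $\alpha\notin\mathcal{C}$) $u(\alpha)=1+A/a$ and $d(\alpha)=\frac1a+\frac{A}{a^2}$, is an association.
   Context: A subset of $F$ is convex if it contains every element lying between two of its elements; sums/products of sets are elementwise, and the operations on $Q$ are independent of representatives. Assembly: a non-empty structure $(\mathcal{A},\ast)$ such that (1) $\ast$ is associative; (2) commutative; (3) for every $x$ there is $e$ with $x\ast e=x$ and such that $x\ast f=x$ implies $e\ast f=e$ (this $e$ is unique, denoted $e(x)$); (4) for every $x$ there is $s$ with $x\ast s=e(x)$ and $e(s)=e(x)$ (unique, denoted $s(x)$); (5) for all $x,y$, $e(x\ast y)=e(x)$ or $e(x\ast y)=e(y)$. Association: a structure $(\mathcal{A},+,\cdot)$ such that $(\mathcal{A},+)$ is an assembly, with neutral operator $e$ and symmetric operator $s$; letting $\mathcal{N}=\{x: x=e(x)\}$ (the magnitudes), $(\mathcal{A}\setminus\mathcal{N},\cdot)$ is an assembly, whose neutral operator is denoted $u$ and symmetric operator $d$; and for all $x,y,z$: (1) $xy+xz=x(y+z)+e(x)y+e(x)z$; (2) there is $w$ with $e(x)y=e(w)$; (3) $e(xy)=e(x)y+e(y)x$; (4)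 if $x\neq e(x)$ then $e(u(x))=e(x)d(x)$; (5) $s(xy)=s(x)y$. *)

theory Defs
  imports Complex_Main "HOL-Library.Set_Algebras"
begin

definition is_neutral :: "'a set \<Rightarrow> ('a \<Rightarrow> 'a \<Rightarrow> 'a) \<Rightarrow> 'a \<Rightarrow> 'a \<Rightarrow> bool" where
  "is_neutral S f x e \<longleftrightarrow> e \<in> S \<and> f x e = x \<and> (\<forall>y\<in>S. f x y = x \<longrightarrow> f e y = e)"

definition neutral_op :: "'a set \<Rightarrow> ('a \<Rightarrow> 'a \<Rightarrow> 'a) \<Rightarrow> 'a \<Rightarrow> 'a" where
  "neutral_op S f x = (THE e. is_neutral S f x e)"

definition is_symmetric :: "'a set \<Rightarrow> ('a \<Rightarrow> 'a \<Rightarrow> 'a) \<Rightarrow> 'a \<Rightarrow> 'a \<Rightarrow> bool" where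
  "is_symmetric S f x s \<longleftrightarrow>
     s \<in> S \<and> f x s = neutral_op S f x \<and> neutral_op S f s = neutral_op S f x"

definition symmetric_op :: "'a set \<Rightarrow> ('a \<Rightarrow> 'a \<Rightarrow> 'a) \<Rightarrow> 'a \<Rightarrow> 'a" where
  "symmetric_op S f x = (THE s. is_symmetric S f x s)"

definition assembly :: "'a set \<Rightarrow> ('a \<Rightarrow> 'a \<Rightarrow> 'a) \<Rightarrow> bool" where
  "assembly S f \<longleftrightarrow>
     S \<noteq> {} \<and>
     (\<forall>x\<in>S. \<forall>y\<in>S. f x y \<in> S) \<and>
     (\<forall>x\<in>S. \<forall>y\<in>S. \<forall>z\<in>S. f x (f y z) = f (f x y) z) \<and>
     (\<forall>x\<in>S. \<forall>y\<in>S. f x y = f y x) \<and>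
     (\<forall>x\<in>S. \<exists>e. is_neutral S f x e) \<and>
     (\<forall>x\<in>S. \<exists>s. is_symmetric S f x s) \<and>
     (\<forall>x\<in>S. \<forall>y\<in>S. neutral_op S f (f x y) = neutral_op S f x \<or>
                   neutral_op S f (f x y) = neutral_op S f y)"

definition magnitudes :: "'a set \<Rightarrow> ('a \<Rightarrow> 'a \<Rightarrow> 'a) \<Rightarrow> 'a set" where
  "magnitudes S f = {x \<in> S. x = neutral_op S f x}"

definition association :: "'a set \<Rightarrow> ('a \<Rightarrow> 'a \<Rightarrow> 'a) \<Rightarrow> ('a \<Rightarrow> 'a \<Rightarrow> 'a) \<Rightarrow> bool" where
  "association S p m \<longleftrightarrow>
     (let e = neutral_op S p; s = symmetric_op S p; Z = S - magnitudes S p;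
          u = neutral_op Z m; d = symmetric_op Z m
      in assembly S p \<and>
         (\<forall>x\<in>S. \<forall>y\<in>S. m x y \<in> S) \<and>
         assembly Z m \<and>
         (\<forall>x\<in>S. \<forall>y\<in>S. \<forall>z\<in>S.
            p (m x y) (m x z) = p (p (m x (p y z)) (m (e x) y)) (m (e x) z)) \<and>
         (\<forall>x\<in>S. \<forall>y\<in>S. \<exists>w\<in>S. m (e x) y = e w) \<and>
         (\<forall>x\<in>S. \<forall>y\<in>S. e (m x y) = p (m (e x) y) (m (e y) x)) \<and>
         (\<forall>x\<in>S. x \<noteq> e x \<longrightarrow> e (u x) = m (e x) (d x)) \<and>
         (\<forall>x\<in>S. \<forall>y\<in>S. s (m x y) = m (s x) y))"

lemma is_neutral_unique:
  assumes "assembly S f" "is_neutral S f x e" "is_neutral S f x e'"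
  shows "e = e'"
proof -
  have e: "e \<in> S" "e' \<in> S" "f x e = x" "f x e' = x"
    using assms(2,3) unfolding is_neutral_def by blast+
  have "f e e' = e" "f e' e = e'" using assms(2,3) e unfolding is_neutral_def by blast+
  moreover have "f e e' = f e' e" using assms(1) e unfolding assembly_def by blast
  ultimately show ?thesis by simp
qed

lemma neutral_op_eqI:
  assumes "assembly S f" "is_neutral S f x e"
  shows "neutral_op S f x = e"
  unfolding neutral_op_def
  by (rule the_equality) (auto intro: assms(2) is_neutral_unique[OF assms(1) _ assms(2)])

lemma is_symmetric_unique:
  assumes S: "assembly S f" and x: "x \<in> S"
    and s: "is_symmetric S f x s" and t: "is_symmetric S f x t"
  shows "s = t"
proof -
  have ne: "f y (neutral_op S f y) = y" if "y \<in> S" for y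
  proof -
    obtain e where "is_neutral S f y e" using S \<open>y \<in> S\<close> unfolding assembly_def by blast
    then show ?thesis using neutral_op_eqI[OF S] by (simp add: is_neutral_def)
  qed
  have assoc: "f a (f b c) = f (f a b) c" and comm: "f a b = f b a"
    if "a \<in> S" "b \<in> S" "c \<in> S" for a b c
    using S that unfolding assembly_def by blast+
  have st: "s \<in> S" "t \<in> S" using s t by (auto simp: is_symmetric_def)
  have "s = f s (f x t)" using ne[OF st(1)] s t by (simp add: is_symmetric_def)
  also have "\<dots> = f t (f x s)" using assoc comm st x by metis
  also have "\<dots> = t" using ne[OF st(2)] s t by (simp add: is_symmetric_def)
  finally show ?thesis .
qed

definition order_convex :: "'a::order set \<Rightarrow> bool" where
  "order_convex S \<longleftrightarrow> (\<forall>x\<in>S. \<forall>y\<in>S. \<forall>z. x \<le> z \<and> z \<le> y \<longrightarrow> z \<in> S)"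

definition add_subgroup :: "'a::ab_group_add set \<Rightarrow> bool" where
  "add_subgroup A \<longleftrightarrow> 0 \<in> A \<and> (\<forall>x\<in>A. \<forall>y\<in>A. x + y \<in> A) \<and> (\<forall>x\<in>A. - x \<in> A)"

definition convex_subgroups :: "'a::linordered_field set set" where
  "convex_subgroups = {A. add_subgroup A \<and> order_convex A}"

definition cosets :: "'a::linordered_field set set" where
  "cosets = {a +o A | a A. A \<in> convex_subgroups}"

text \<open>The operations on cosets are given by formulas in representatives; below they are shown
  not to depend on the choice.  Outside \<^const>\<open>cosets\<close> their values are irrelevant.\<close>

definition coset_add :: "'a::linordered_field set \<Rightarrow> 'a set \<Rightarrow> 'a set" where
  "coset_add \<alpha> \<beta> = (THE \<gamma>. \<forall>a b. \<forall>A\<in>convex_subgroups. \<forall>B\<in>convex_subgroups.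
     \<alpha> = a +o A \<and> \<beta> = b +o B \<longrightarrow> \<gamma> = (a + b) +o (A + B))"

definition coset_mult :: "'a::linordered_field set \<Rightarrow> 'a set \<Rightarrow> 'a set" where
  "coset_mult \<alpha> \<beta> = (THE \<gamma>. \<forall>a b. \<forall>A\<in>convex_subgroups. \<forall>B\<in>convex_subgroups.
     \<alpha> = a +o A \<and> \<beta> = b +o B \<longrightarrow> \<gamma> = (a * b) +o (a *o B + b *o A + A * B))"

lemma convex_subgroupsD:
  assumes "A \<in> convex_subgroups"
  shows "0 \<in> A" "x \<in> A \<Longrightarrow> y \<in> A \<Longrightarrow> x + y \<in> A" "x \<in> A \<Longrightarrow> - x \<in> A"
    "x \<in> A \<Longrightarrow> y \<in> A \<Longrightarrow> x - y \<in> A"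
    "x \<in> A \<Longrightarrow> y \<in> A \<Longrightarrow> x \<le> z \<Longrightarrow> z \<le> y \<Longrightarrow> z \<in> A"
proof -
  show 0: "0 \<in> A" and add: "x \<in> A \<Longrightarrow> y \<in> A \<Longrightarrow> x + y \<in> A" and minus: "x \<in> A \<Longrightarrow> - x \<in> A"
    and "x \<in> A \<Longrightarrow> y \<in> A \<Longrightarrow> x \<le> z \<Longrightarrow> z \<le> y \<Longrightarrow> z \<in> A" for x y z
    using assms unfolding convex_subgroups_def add_subgroup_def order_convex_def by blast+
  show "x - y \<in> A" if "x \<in> A" "y \<in> A"
    using add[OF that(1) minus[OF that(2)]] by simp
qed

lemma convex_subgroups_abs:
  assumes A: "A \<in> convex_subgroups" and "x \<in> A" "\<bar>z\<bar> \<le> \<bar>x\<bar>"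
  shows "z \<in> A"
proof -
  have "\<bar>x\<bar> \<in> A" using assms convex_subgroupsD(3)[OF A] by (auto simp: abs_if)
  moreover have "- \<bar>x\<bar> \<le> z" "z \<le> \<bar>x\<bar>" using assms(3) by linarith+
  ultimately show ?thesis using convex_subgroupsD(3,5)[OF A] by blast
qed

lemma convex_subgroups_times_add:
  assumes A: "A \<in> convex_subgroups" and B: "B \<in> convex_subgroups"
    and "p \<in> A * B" "q \<in> A * B"
  shows "p + q \<in> A * B"
proof -
  obtain x y x' y' where xy: "x \<in> A" "y \<in> B" "x' \<in> A" "y' \<in> B" "p = x * y" "q = x' * y'"
    using assms(3,4) by (auto elim!: set_times_elim)
  define X where "X = max \<bar>x\<bar> \<bar>x'\<bar>"
  define Y where "Y = max \<bar>y\<bar> \<bar>y'\<bar>"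
  have X: "X \<in> A" unfolding X_def max_def using convex_subgroups_abs[OF A] xy by simp
  have Y: "Y \<in> B" unfolding Y_def max_def using convex_subgroups_abs[OF B] xy by simp
  have le: "\<bar>p + q\<bar> \<le> X * (Y + Y)"
  proof -
    have "\<bar>p\<bar> \<le> X * Y" "\<bar>q\<bar> \<le> X * Y"
      unfolding xy abs_mult X_def Y_def by (intro mult_mono; simp add: le_max_iff_disj)+
    then show ?thesis by (simp add: distrib_left)
  qed
  show ?thesis
  proof (cases "X = 0")
    case True
    then have "p + q = 0 * 0" using le by simp
    then show ?thesis using convex_subgroupsD(1)[OF A] convex_subgroupsD(1)[OF B]
      by (metis set_times_intro)
  next
    case False
    then have pos: "X > 0" unfolding X_def by (auto simp: less_max_iff_disj max_def split: if_splits)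
    have "\<bar>(p + q) / X\<bar> \<le> \<bar>Y + Y\<bar>"
    proof -
      have "\<bar>(p + q) / X\<bar> \<le> Y + Y"
        using le pos by (simp add: abs_divide pos_divide_le_eq mult.commute)
      then show ?thesis by linarith
    qed
    then have "(p + q) / X \<in> B" using convex_subgroups_abs[OF B] convex_subgroupsD(2)[OF B] Y by blast
    then have "X * ((p + q) / X) \<in> A * B" using X by blast
    then show ?thesis using False by simp
  qed
qed

lemma elt_set_plus_eqD:
  assumes A: "A \<in> convex_subgroups" and A': "A' \<in> convex_subgroups" and eq: "a +o A = a' +o A'"
  shows "A' = A" "a' - a \<in> A"
proof -
  have mem: "x - a \<in> A \<longleftrightarrow> x - a' \<in> A'" for x
    using eq by (metis set_minus_plus)
  show d: "a' - a \<in> A" using mem[of a'] convex_subgroupsD(1)[OF A'] by simp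
  have "x \<in> A' \<longleftrightarrow> x \<in> A" for x
  proof -
    have "x \<in> A' \<longleftrightarrow> x + (a' - a) \<in> A" using mem[of "x + a'"] by (simp add: algebra_simps)
    also have "\<dots> \<longleftrightarrow> x \<in> A"
      using d convex_subgroupsD(2,4)[OF A] by (metis add_diff_cancel_right')
    finally show ?thesis .
  qed
  then show "A' = A" by blast
qed

lemma coset_add_eq:
  assumes A: "A \<in> convex_subgroups" and B: "B \<in> convex_subgroups"
  shows "coset_add (a +o A) (b +o B) = (a + b) +o (A + B)"
proof -
  have "(a + b) +o (A + B) = (a' + b') +o (A' + B')"
    if "A' \<in> convex_subgroups" "B' \<in> convex_subgroups" "a +o A = a' +o A'" "b +o B = b' +o B'"
    for a' b' A' B'
    using that by (metis set_plus_rearrange)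
  then show ?thesis unfolding coset_add_def using A B by (intro the_equality) blast+
qed

lemma coset_mult_subset:
  assumes A: "A \<in> convex_subgroups" and B: "B \<in> convex_subgroups"
    and x: "a' - a \<in> A" and y: "b' - b \<in> B"
  shows "(a' * b') +o (a' *o B + b' *o A + A * B) \<subseteq> (a * b) +o (a *o B + b *o A + A * B)"
proof
  fix t assume "t \<in> (a' * b') +o (a' *o B + b' *o A + A * B)"
  then obtain \<beta> \<alpha> q where t: "t = a' * b' + (a' * \<beta> + b' * \<alpha> + q)" "\<beta> \<in> B" "\<alpha> \<in> A" "q \<in> A * B"
    by (auto simp: elt_set_plus_def elt_set_times_def set_plus_def)
  define x where "x = a' - a"
  define y where "y = b' - b"
  have xy: "x \<in> A" "y \<in> B" using assms by (auto simp: x_def y_def)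
  have ab: "a' = a + x" "b' = b + y" by (auto simp: x_def y_def)
  have "x * y + x * \<beta> + \<alpha> * y + q \<in> A * B"
    using t xy by (intro convex_subgroups_times_add[OF A B]) auto
  moreover have "y + \<beta> \<in> B" "x + \<alpha> \<in> A" using t xy convex_subgroupsD(2) A B by blast+
  moreover have "t = a * b + (a * (y + \<beta>) + b * (x + \<alpha>) + (x * y + x * \<beta> + \<alpha> * y + q))"
    unfolding t ab by (simp add: algebra_simps)
  ultimately show "t \<in> (a * b) +o (a *o B + b *o A + A * B)"
    by (auto intro!: set_plus_intro2 set_plus_intro set_times_intro2)
qed

lemma coset_mult_eq:
  assumes A: "A \<in> convex_subgroups" and B: "B \<in> convex_subgroups"
  shows "coset_mult (a +o A) (b +o B) = (a * b) +o (a *o B + b *o A + A * B)"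
proof -
  have "(a * b) +o (a *o B + b *o A + A * B) = (a' * b') +o (a' *o B' + b' *o A' + A' * B')"
    if h: "A' \<in> convex_subgroups" "B' \<in> convex_subgroups" "a +o A = a' +o A'" "b +o B = b' +o B'"
    for a' b' A' B'
  proof -
    have e: "A' = A" "a' - a \<in> A" "B' = B" "b' - b \<in> B"
      using elt_set_plus_eqD A B h by blast+
    then have "a - a' \<in> A" "b - b' \<in> B"
      using convex_subgroupsD(3)[OF A, of "a' - a"] convex_subgroupsD(3)[OF B, of "b' - b"] by simp_all
    then show ?thesis using e coset_mult_subset[OF A B] by (metis subset_antisym)
  qed
  then show ?thesis unfolding coset_mult_def using A B by (intro the_equality) blast+
qed

end

theory Submission
  imports Defs "HOL-Algebra.Coset"
begin

text \<open>
  The cosets of a chain of subgroups of an abelian group always form an assembly: \<open>H K\<close> is the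
  larger of \<open>H\<close> and \<open>K\<close>, the neutral element of \<open>g H\<close> is \<open>H\<close>, and its symmetric element is
  \<open>g\<inverse> H\<close>. Convex subgroups of \<open>F\<close> form a chain, which gives the additive assembly. A zeroless coset
  \<open>a + A\<close> equals \<open>a (1 + A / a)\<close>, and \<open>E = A / a\<close> is a convex subgroup with \<open>1 \<notin> E\<close>. All elements of
  such an \<open>E\<close> are smaller than \<open>1 / 2\<close> in absolute value, so \<open>1 + E\<close> is a subgroup of the units of
  \<open>F\<close>; these subgroups form a chain too, which gives the multiplicative assembly. The
  remaining axioms are identities between products and sums of convex subgroups, and hold because
  products distribute over sums when every sum is one of its summands.
\<close>

section \<open>Cosets of a chain of subgroups\<close>

lemma neutral_op_eqI_commutative:
  assumes comm: "\<And>x y. x \<in> S \<Longrightarrow> y \<in> S \<Longrightarrow> f x y = f y x" and e: "is_neutral S f x e"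
  shows "neutral_op S f x = e"
  unfolding neutral_op_def
proof (rule the_equality[where P = "is_neutral S f x", OF e])
  fix e' assume "is_neutral S f x e'"
  then have "e' \<in> S" "e \<in> S" "f e e' = e" "f e' e = e'"
    using e unfolding is_neutral_def by blast+
  then show "e' = e" using comm by metis
qed

lemma symmetric_op_eqI:
  assumes "assembly S f" "x \<in> S" "is_symmetric S f x s"
  shows "symmetric_op S f x = s"
  unfolding symmetric_op_def
  by (rule the_equality) (auto intro: assms(3) is_symmetric_unique[OF assms(1,2) _ assms(3)])

lemma (in group) set_mult_subgroup_absorb:
  assumes H: "subgroup H G" and K: "subgroup K G" and "H \<subseteq> K"
  shows "H <#> K = K" "K <#> H = K"
proof -
  have "k \<in> H <#> K" "k \<in> K <#> H" if "k \<in> K" for k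
    using subgroup.one_closed[OF H] subgroup.mem_carrier[OF K that] that
    unfolding set_mult_def by force+
  moreover have "H <#> K \<subseteq> K" "K <#> H \<subseteq> K"
    using mono_set_mult[of H K K K G] mono_set_mult[of K K H K G] \<open>H \<subseteq> K\<close> subgroup_mult_id[OF K]
    by auto
  ultimately show "H <#> K = K" "K <#> H = K" by blast+
qed

definition coset_family :: "('a, 'b) monoid_scheme \<Rightarrow> 'a set set \<Rightarrow> 'a set set" where
  "coset_family G \<C> = {g <#\<^bsub>G\<^esub> H | g H. g \<in> carrier G \<and> H \<in> \<C>}"

lemma coset_familyI: "g \<in> carrier G \<Longrightarrow> H \<in> \<C> \<Longrightarrow> g <#\<^bsub>G\<^esub> H \<in> coset_family G \<C>"
  unfolding coset_family_def by blast

lemma coset_familyE: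
  assumes "\<alpha> \<in> coset_family G \<C>"
  obtains g H where "g \<in> carrier G" "H \<in> \<C>" "\<alpha> = g <#\<^bsub>G\<^esub> H"
  using assms unfolding coset_family_def by blast

locale coset_operation = comm_group G for G :: "('a, 'b) monoid_scheme" (structure) +
  fixes \<C> :: "'a set set" and f :: "'a set \<Rightarrow> 'a set \<Rightarrow> 'a set"
  assumes chain_nonempty: "\<C> \<noteq> {}"
    and chain_subgroup: "H \<in> \<C> \<Longrightarrow> subgroup H G"
    and chain_linear: "H \<in> \<C> \<Longrightarrow> K \<in> \<C> \<Longrightarrow> H \<subseteq> K \<or> K \<subseteq> H"
    and op_l_coset: "\<lbrakk>g \<in> carrier G; k \<in> carrier G; H \<in> \<C>; K \<in> \<C>\<rbrakk>
      \<Longrightarrow> f (g <# H) (k <# K) = (g \<otimes> k) <# (H <#> K)"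
begin

lemma chain_subset_carrier: "H \<in> \<C> \<Longrightarrow> H \<subseteq> carrier G"
  by (rule subgroup.subset[OF chain_subgroup])

lemma chain_set_mult_cases:
  assumes "H \<in> \<C>" "K \<in> \<C>"
  shows "H <#> K = H \<and> K <#> H = H \<or> H <#> K = K \<and> K <#> H = K"
  using chain_linear[OF assms] set_mult_subgroup_absorb chain_subgroup assms by metis

lemma chain_set_mult_closed: "H \<in> \<C> \<Longrightarrow> K \<in> \<C> \<Longrightarrow> H <#> K \<in> \<C>"
  using chain_set_mult_cases by metis

lemma op_subgroup_l_coset:
  "\<lbrakk>k \<in> carrier G; H \<in> \<C>; K \<in> \<C>\<rbrakk> \<Longrightarrow> f H (k <# K) = k <# (H <#> K)"
  using op_l_coset[of \<one> k H K] by (simp add: lcos_mult_one chain_subset_carrier)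

lemma op_commute:
  assumes "\<alpha> \<in> coset_family G \<C>" "\<beta> \<in> coset_family G \<C>"
  shows "f \<alpha> \<beta> = f \<beta> \<alpha>"
proof -
  obtain g H k K where "g \<in> carrier G" "H \<in> \<C>" "\<alpha> = g <# H" "k \<in> carrier G" "K \<in> \<C>" "\<beta> = k <# K"
    using assms by (elim coset_familyE)
  moreover have "H <#> K = K <#> H" using chain_set_mult_cases \<open>H \<in> \<C>\<close> \<open>K \<in> \<C>\<close> by metis
  ultimately show ?thesis by (simp add: op_l_coset m_comm)
qed

lemma subgroup_in_coset_family: "H \<in> \<C> \<Longrightarrow> H \<in> coset_family G \<C>"
  using coset_familyI[of \<one> G H \<C>] by (simp add: lcos_mult_one chain_subset_carrier)

lemma is_neutral_l_coset:
  assumes g: "g \<in> carrier G" and H: "H \<in> \<C>"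
  shows "is_neutral (coset_family G \<C>) f (g <# H) H"
  unfolding is_neutral_def
proof (intro conjI ballI impI)
  show "H \<in> coset_family G \<C>" by (rule subgroup_in_coset_family[OF H])
  show "f (g <# H) H = g <# H"
    using op_l_coset[OF g one_closed H H] g H
    by (simp add: lcos_mult_one chain_subset_carrier subgroup_mult_id chain_subgroup)
  fix \<beta> assume "\<beta> \<in> coset_family G \<C>" and eq: "f (g <# H) \<beta> = g <# H"
  then obtain k K where k: "k \<in> carrier G" and K: "K \<in> \<C>" and \<beta>: "\<beta> = k <# K"
    by (elim coset_familyE)
  note HK = chain_set_mult_closed[OF H K]
  have "inv g <# ((g \<otimes> k) <# (H <#> K)) = inv g <# (g <# H)"
    using eq g k H K by (simp add: \<beta> op_l_coset)
  then have l_coset_eq: "k <# (H <#> K) = H"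
    using g k H HK
    by (simp add: lcos_m_assoc lcos_mult_one chain_subset_carrier m_assoc[symmetric])
  show "f H \<beta> = H"
    by (simp add: \<beta> op_subgroup_l_coset[OF k H K] l_coset_eq)
qed

lemma neutral_op_l_coset:
  "g \<in> carrier G \<Longrightarrow> H \<in> \<C> \<Longrightarrow> neutral_op (coset_family G \<C>) f (g <# H) = H"
  by (rule neutral_op_eqI_commutative[OF op_commute is_neutral_l_coset])

lemma is_symmetric_l_coset:
  "g \<in> carrier G \<Longrightarrow> H \<in> \<C> \<Longrightarrow> is_symmetric (coset_family G \<C>) f (g <# H) (inv g <# H)"
  by (simp add: is_symmetric_def coset_familyI neutral_op_l_coset op_l_coset subgroup_mult_id
      chain_subgroup lcos_mult_one chain_subset_carrier)

theorem assembly_coset_family: "assembly (coset_family G \<C>) f"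
  unfolding assembly_def
proof (intro conjI ballI)
  show "coset_family G \<C> \<noteq> {}" using chain_nonempty subgroup_in_coset_family by blast
  fix \<alpha> assume \<alpha>: "\<alpha> \<in> coset_family G \<C>"
  then obtain g H where gH: "g \<in> carrier G" "H \<in> \<C>" "\<alpha> = g <# H" by (elim coset_familyE)
  show "\<exists>e. is_neutral (coset_family G \<C>) f \<alpha> e" "\<exists>s. is_symmetric (coset_family G \<C>) f \<alpha> s"
    using gH is_neutral_l_coset is_symmetric_l_coset by blast+
  fix \<beta> assume \<beta>: "\<beta> \<in> coset_family G \<C>"
  then obtain k K where kK: "k \<in> carrier G" "K \<in> \<C>" "\<beta> = k <# K" by (elim coset_familyE)
  show "f \<alpha> \<beta> \<in> coset_family G \<C>"
    using gH kK by (simp add: op_l_coset coset_familyI chain_set_mult_closed)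
  show "f \<alpha> \<beta> = f \<beta> \<alpha>" by (rule op_commute[OF \<alpha> \<beta>])
  show "neutral_op (coset_family G \<C>) f (f \<alpha> \<beta>) = neutral_op (coset_family G \<C>) f \<alpha> \<or>
        neutral_op (coset_family G \<C>) f (f \<alpha> \<beta>) = neutral_op (coset_family G \<C>) f \<beta>"
    using chain_set_mult_cases[OF gH(2) kK(2)] gH kK
    by (auto simp: op_l_coset neutral_op_l_coset)
  fix \<gamma> assume "\<gamma> \<in> coset_family G \<C>"
  then obtain l L where "l \<in> carrier G" "L \<in> \<C>" "\<gamma> = l <# L" by (elim coset_familyE)
  then show "f \<alpha> (f \<beta> \<gamma>) = f (f \<alpha> \<beta>) \<gamma>"
    using gH kK
    by (simp add: op_l_coset chain_set_mult_closed m_assoc set_mult_assoc chain_subset_carrier)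
qed

lemma symmetric_op_l_coset:
  "g \<in> carrier G \<Longrightarrow> H \<in> \<C> \<Longrightarrow> symmetric_op (coset_family G \<C>) f (g <# H) = inv g <# H"
  by (rule symmetric_op_eqI[OF assembly_coset_family coset_familyI is_symmetric_l_coset])

end

section \<open>Convex subgroups\<close>

lemma convex_subgroupsI:
  assumes "0 \<in> A" and "\<And>x y. x \<in> A \<Longrightarrow> y \<in> A \<Longrightarrow> x + y \<in> A"
    and abs: "\<And>x z. x \<in> A \<Longrightarrow> \<bar>z\<bar> \<le> \<bar>x\<bar> \<Longrightarrow> z \<in> A"
  shows "A \<in> convex_subgroups"
proof -
  have "- x \<in> A" if "x \<in> A" for x using abs[OF that, of "- x"] by simp
  then have "add_subgroup A" using assms(1,2) unfolding add_subgroup_def by blast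
  moreover have "order_convex A"
    unfolding order_convex_def
  proof (intro ballI allI impI)
    fix x y z assume xy: "x \<in> A" "y \<in> A" and "x \<le> z \<and> z \<le> y"
    then have "\<bar>z\<bar> \<le> \<bar>x\<bar> \<or> \<bar>z\<bar> \<le> \<bar>y\<bar>" by linarith
    then show "z \<in> A" using abs xy by blast
  qed
  ultimately show ?thesis unfolding convex_subgroups_def by blast
qed

lemma convex_subgroups_linear:
  assumes A: "A \<in> convex_subgroups" and B: "B \<in> convex_subgroups"
  shows "A \<subseteq> B \<or> B \<subseteq> A"
proof (rule ccontr)
  assume "\<not> ?thesis"
  then obtain x y where "x \<in> A" "x \<notin> B" "y \<in> B" "y \<notin> A" by blast
  then show False
    using convex_subgroups_abs[OF A, of x y] convex_subgroups_abs[OF B, of y x] by linarith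
qed

lemma zero_convex_subgroup: "{0} \<in> convex_subgroups"
  by (rule convex_subgroupsI) auto

section \<open>The additive assembly\<close>

definition additive_group :: "'a::ab_group_add monoid" where
  "additive_group = \<lparr>carrier = UNIV, mult = (+), one = 0\<rparr>"

lemma additive_group_simps:
  fixes x y :: "'a::ab_group_add"
  shows "carrier additive_group = (UNIV :: 'a set)"
    and "x \<otimes>\<^bsub>additive_group\<^esub> y = x + y"
    and "\<one>\<^bsub>additive_group\<^esub> = (0 :: 'a)"
    and "l_coset additive_group = ((+o) :: 'a \<Rightarrow> _)"
    and "set_mult additive_group = ((+) :: 'a set \<Rightarrow> _)"
  by (auto simp: fun_eq_iff l_coset_def set_mult_def elt_set_plus_def set_plus_def
      additive_group_def)

lemma comm_group_additive_group: "comm_group (additive_group :: 'a::ab_group_add monoid)"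
proof (rule comm_groupI)
  show "\<exists>y\<in>carrier additive_group. y \<otimes>\<^bsub>additive_group\<^esub> x = \<one>\<^bsub>additive_group\<^esub>" for x :: 'a
    by (auto simp: additive_group_simps intro: exI[of _ "- x"])
qed (auto simp: additive_group_simps ac_simps)

lemma m_inv_additive_group: "m_inv additive_group = (uminus :: 'a \<Rightarrow> 'a::ab_group_add)"
proof
  show "inv\<^bsub>additive_group\<^esub> x = - x" for x :: 'a
    by (rule group.inv_equality[OF comm_group.axioms(2)[OF comm_group_additive_group]])
      (simp_all add: additive_group_simps)
qed

lemma subgroup_convex_subgroup:
  assumes "A \<in> convex_subgroups"
  shows "subgroup A additive_group"
  using convex_subgroupsD(1-3)[OF assms]
  by unfold_locales (simp_all add: m_inv_additive_group additive_group_simps)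

lemma cosetsI: "A \<in> convex_subgroups \<Longrightarrow> a +o A \<in> cosets"
  unfolding cosets_def by blast

lemma cosetsE:
  assumes "\<alpha> \<in> cosets"
  obtains a A where "A \<in> convex_subgroups" "\<alpha> = a +o A"
  using assms unfolding cosets_def by blast

interpretation coset_add: coset_operation
  "additive_group :: 'a::linordered_field monoid" convex_subgroups coset_add
  rewrites "carrier additive_group = (UNIV :: 'a set)"
    and "l_coset additive_group = ((+o) :: 'a \<Rightarrow> _)"
    and "set_mult additive_group = ((+) :: 'a set \<Rightarrow> _)"
    and "m_inv additive_group = (uminus :: 'a \<Rightarrow> 'a)"
    and "coset_family additive_group convex_subgroups = (cosets :: 'a set set)"
proof -
  show "coset_operation additive_group convex_subgroups (coset_add :: 'a set \<Rightarrow> _)"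
  proof (intro coset_operation.intro coset_operation_axioms.intro)
    show "comm_group (additive_group :: 'a monoid)" by (rule comm_group_additive_group)
    show "convex_subgroups \<noteq> ({} :: 'a set set)" using zero_convex_subgroup by blast
  qed (simp_all add: subgroup_convex_subgroup convex_subgroups_linear additive_group_simps
      coset_add_eq)
  show "coset_family additive_group convex_subgroups = (cosets :: 'a set set)"
    by (auto simp: coset_family_def cosets_def additive_group_simps)
qed (simp_all add: additive_group_simps m_inv_additive_group)

lemma convex_subgroups_plus_absorb:
  assumes "A \<in> convex_subgroups" "B \<in> convex_subgroups" "A \<subseteq> B"
  shows "A + B = B" "B + A = B"
  by (rule coset_add.set_mult_subgroup_absorb[OF assms(1,2)[THEN subgroup_convex_subgroup]
      assms(3)])+

lemma convex_subgroups_plus_idem: "A \<in> convex_subgroups \<Longrightarrow> A + A = A"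
  by (simp add: convex_subgroups_plus_absorb)

section \<open>Products of convex subgroups\<close>

lemma mem_scale_iff: "a \<noteq> 0 \<Longrightarrow> x \<in> a *o A \<longleftrightarrow> x / a \<in> (A :: 'a::field set)"
  by (force simp: elt_set_times_def)

lemma zero_scale: "A \<noteq> {} \<Longrightarrow> 0 *o A = {0 :: 'a::mult_zero}"
  by (auto simp: elt_set_times_def)

lemma convex_subgroups_nonempty: "A \<in> convex_subgroups \<Longrightarrow> A \<noteq> {}"
  using convex_subgroupsD(1) by blast

lemma convex_subgroups_scale:
  assumes A: "A \<in> convex_subgroups"
  shows "a *o A \<in> convex_subgroups"
proof (cases "a = 0")
  case True
  then show ?thesis
    using zero_convex_subgroup by (simp add: zero_scale convex_subgroups_nonempty[OF A])
next
  case False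
  show ?thesis
  proof (rule convex_subgroupsI)
    show "0 \<in> a *o A" using False convex_subgroupsD(1)[OF A] by (simp add: mem_scale_iff)
    show "x + y \<in> a *o A" if "x \<in> a *o A" "y \<in> a *o A" for x y
      using False that convex_subgroupsD(2)[OF A] by (simp add: mem_scale_iff add_divide_distrib)
    show "z \<in> a *o A" if "x \<in> a *o A" "\<bar>z\<bar> \<le> \<bar>x\<bar>" for x z
      using False that convex_subgroups_abs[OF A, of "x / a" "z / a"]
      by (simp add: mem_scale_iff divide_right_mono)
  qed
qed

lemma convex_subgroups_times:
  assumes A: "A \<in> convex_subgroups" and B: "B \<in> convex_subgroups"
  shows "A * B \<in> convex_subgroups"
proof (rule convex_subgroupsI)
  show "0 \<in> A * B"
    using set_times_intro[OF convex_subgroupsD(1)[OF A] convex_subgroupsD(1)[OF B]] by simp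
  show "x + y \<in> A * B" if "x \<in> A * B" "y \<in> A * B" for x y
    using convex_subgroups_times_add[OF A B that] .
  show "z \<in> A * B" if x: "x \<in> A * B" "\<bar>z\<bar> \<le> \<bar>x\<bar>" for x z
  proof -
    obtain p q where pq: "p \<in> A" "q \<in> B" "x = p * q" using x(1) by (auto elim!: set_times_elim)
    then have "z \<in> p *o B"
      using convex_subgroups_abs[OF convex_subgroups_scale[OF B], of x p z] x by blast
    then show ?thesis using pq(1) set_times_mono3 by blast
  qed
qed

lemmas convex_subgroups_closed =
  coset_add.chain_set_mult_closed convex_subgroups_scale convex_subgroups_times

lemma times_plus_distrib_convex_subgroups:
  assumes A: "A \<in> convex_subgroups" and B: "B \<in> convex_subgroups" and C: "C \<in> convex_subgroups"
  shows "A * (B + C) = A * B + A * C"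
proof -
  have distrib_if_subset: "A * (B + C) = A * B + A * C"
    if "B \<in> convex_subgroups" "C \<in> convex_subgroups" "B \<subseteq> C" for B C
    using that A set_times_mono2[of A A B C]
    by (simp add: convex_subgroups_plus_absorb convex_subgroups_times)
  show ?thesis
    using convex_subgroups_linear[OF B C] distrib_if_subset[OF B C] distrib_if_subset[OF C B]
    by (auto simp: add.commute)
qed

lemma scale_minus_convex_subgroup:
  assumes A: "A \<in> convex_subgroups"
  shows "(- a) *o A = a *o A"
proof -
  have "uminus ` A = A"
    using convex_subgroupsD(3)[OF A] by force
  moreover have "(- a) *o A = a *o (uminus ` A)" by (auto simp: elt_set_times_def)
  ultimately show ?thesis by simp
qed

lemma scale_add_subset: "(b + c) *o A \<subseteq> b *o A + c *o (A :: 'a::semiring set)"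
  by (auto simp: elt_set_times_def distrib_right)

lemma times_subset_scale_convex_subgroup:
  assumes A: "A \<in> convex_subgroups" and B: "B \<in> convex_subgroups" and a: "a \<notin> A"
  shows "A * B \<subseteq> a *o B"
proof
  fix t assume "t \<in> A * B"
  then obtain x y where xy: "x \<in> A" "y \<in> B" "t = x * y" by (auto elim!: set_times_elim)
  have "\<bar>x\<bar> \<le> \<bar>a\<bar>" using convex_subgroups_abs[OF A xy(1), of a] a by linarith
  then have "\<bar>t\<bar> \<le> \<bar>a * y\<bar>" using xy by (simp add: abs_mult mult_right_mono)
  then show "t \<in> a *o B"
    using convex_subgroups_abs[OF convex_subgroups_scale[OF B]] xy(2) by blast
qed

section \<open>The multiplicative assembly\<close>

definition units_group :: "'a::field monoid" where
  "units_group = \<lparr>carrier = UNIV - {0}, mult = (*), one = 1\<rparr>"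

lemma units_group_simps:
  fixes x y :: "'a::field"
  shows "carrier units_group = UNIV - {0 :: 'a}"
    and "x \<otimes>\<^bsub>units_group\<^esub> y = x * y"
    and "\<one>\<^bsub>units_group\<^esub> = (1 :: 'a)"
    and "l_coset units_group = ((*o) :: 'a \<Rightarrow> _)"
    and "set_mult units_group = ((*) :: 'a set \<Rightarrow> _)"
  by (auto simp: fun_eq_iff l_coset_def set_mult_def elt_set_times_def set_times_def
      units_group_def)

lemma comm_group_units_group: "comm_group (units_group :: 'a::field monoid)"
proof (rule comm_groupI)
  show "\<exists>y\<in>carrier units_group. y \<otimes>\<^bsub>units_group\<^esub> x = \<one>\<^bsub>units_group\<^esub>"
    if "x \<in> carrier units_group" for x :: 'a
    using that by (auto simp: units_group_simps intro!: bexI[of _ "inverse x"])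
qed (auto simp: units_group_simps ac_simps)

lemma group_units_group: "group (units_group :: 'a::field monoid)"
  by (rule comm_group.axioms(2)[OF comm_group_units_group])

lemma m_inv_units_group: "x \<noteq> 0 \<Longrightarrow> inv\<^bsub>units_group\<^esub> x = inverse (x :: 'a::field)"
  by (rule group.inv_equality[OF group_units_group]) (simp_all add: units_group_simps)

definition convex_unit_groups :: "'a::linordered_field set set" where
  "convex_unit_groups = {1 +o E | E. E \<in> convex_subgroups \<and> 1 \<notin> E}"

lemma convex_unit_groupsI: "E \<in> convex_subgroups \<Longrightarrow> 1 \<notin> E \<Longrightarrow> 1 +o E \<in> convex_unit_groups"
  unfolding convex_unit_groups_def by blast

lemma convex_unit_groupsE:
  assumes "U \<in> convex_unit_groups"
  obtains E where "E \<in> convex_subgroups" "1 \<notin> E" "U = 1 +o E"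
  using assms unfolding convex_unit_groups_def by blast

lemma abs_less_half_if_one_notin:
  assumes E: "E \<in> convex_subgroups" and "1 \<notin> E" "x \<in> E"
  shows "\<bar>x\<bar> < 1 / 2"
proof (rule ccontr)
  assume "\<not> ?thesis"
  then have "\<bar>1\<bar> \<le> \<bar>x + x\<bar>" by linarith
  then show False
    using convex_subgroups_abs[OF E convex_subgroupsD(2)[OF E \<open>x \<in> E\<close> \<open>x \<in> E\<close>]] \<open>1 \<notin> E\<close> by blast
qed

lemma inverse_mem_one_plus:
  assumes E: "E \<in> convex_subgroups" and "1 \<notin> E" "x \<in> E"
  shows "inverse (1 + x) \<in> 1 +o E"
proof -
  have half: "1 / 2 < \<bar>1 + x\<bar>" using abs_less_half_if_one_notin[OF assms] by linarith
  then have "\<bar>x\<bar> * 1 \<le> \<bar>x\<bar> * (2 * \<bar>1 + x\<bar>)" by (intro mult_left_mono) auto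
  then have "\<bar>x\<bar> / \<bar>1 + x\<bar> \<le> 2 * \<bar>x\<bar>" using half by (simp add: divide_le_eq algebra_simps)
  moreover have "inverse (1 + x) - 1 = - x / (1 + x)"
  proof -
    have "1 + x \<noteq> 0" using half by auto
    then show ?thesis by (simp add: field_simps)
  qed
  ultimately have "\<bar>inverse (1 + x) - 1\<bar> \<le> \<bar>x + x\<bar>" by simp
  then have "inverse (1 + x) - 1 \<in> E"
    using convex_subgroups_abs[OF E] convex_subgroupsD(2)[OF E \<open>x \<in> E\<close> \<open>x \<in> E\<close>] by blast
  then show ?thesis by (simp add: set_minus_plus)
qed

lemma subgroup_convex_unit_group:
  assumes "U \<in> convex_unit_groups"
  shows "subgroup U units_group"
proof -
  obtain E where E: "E \<in> convex_subgroups" and one: "1 \<notin> E" and U: "U = 1 +o E"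
    using assms by (rule convex_unit_groupsE)
  have mem: "u \<in> U \<longleftrightarrow> u - 1 \<in> E" for u by (simp add: U set_minus_plus)
  have nonzero: "u \<noteq> 0" if "u \<in> U" for u
    using that convex_subgroupsD(3)[OF E, of "- 1"] one by (auto simp: mem)
  show ?thesis
  proof (rule group.subgroupI[OF group_units_group])
    show "U \<subseteq> carrier units_group" using nonzero by (auto simp: units_group_simps)
    show "U \<noteq> {}" using convex_subgroupsD(1)[OF E] by (auto simp: U)
    show "inv\<^bsub>units_group\<^esub> u \<in> U" if "u \<in> U" for u
      using that nonzero[OF that] inverse_mem_one_plus[OF E one, of "u - 1"]
      by (simp add: mem m_inv_units_group set_minus_plus[symmetric])
    show "u \<otimes>\<^bsub>units_group\<^esub> v \<in> U" if uv: "u \<in> U" "v \<in> U" for u v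
    proof -
      have "\<bar>(u - 1) * (v - 1)\<bar> \<le> \<bar>v - 1\<bar>"
        using abs_less_half_if_one_notin[OF E one, of "u - 1"] uv(1)
        by (simp add: mem abs_mult mult_left_le_one_le)
      then have "(u - 1) * (v - 1) \<in> E" using convex_subgroups_abs[OF E] uv(2) mem by blast
      then have "(u - 1) + (v - 1) + (u - 1) * (v - 1) \<in> E"
        using uv mem convex_subgroupsD(2)[OF E] by blast
      then show ?thesis by (simp add: mem units_group_simps algebra_simps)
    qed
  qed
qed

lemma convex_unit_groups_linear:
  assumes "U \<in> convex_unit_groups" "V \<in> convex_unit_groups"
  shows "U \<subseteq> V \<or> V \<subseteq> U"
proof -
  obtain E E' where "E \<in> convex_subgroups" "U = 1 +o E" "E' \<in> convex_subgroups" "V = 1 +o E'"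
    using assms by (elim convex_unit_groupsE)
  then show ?thesis
    using convex_subgroups_linear[of E E'] set_plus_mono[of E E' 1] set_plus_mono[of E' E 1]
    by metis
qed

lemma one_plus_times_one_plus:
  assumes "E \<in> convex_subgroups" "1 \<notin> E" "E' \<in> convex_subgroups" "1 \<notin> E'"
  shows "(1 +o E) * (1 +o E') = 1 +o (E + E')"
proof -
  have subgroups: "subgroup (1 +o E) units_group" "subgroup (1 +o E') units_group"
    using assms by (simp_all add: subgroup_convex_unit_group convex_unit_groupsI)
  note absorb = group.set_mult_subgroup_absorb[OF group_units_group, unfolded units_group_simps]
  consider (subset) "E \<subseteq> E'" | (superset) "E' \<subseteq> E" using convex_subgroups_linear assms by blast
  then show ?thesis
  proof cases
    case subset
    then show ?thesis
      using absorb(1)[OF subgroups] assms by (simp add: convex_subgroups_plus_absorb set_plus_mono)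
  next
    case superset
    then show ?thesis
      using absorb(2)[OF subgroups(2,1)] assms
      by (simp add: convex_subgroups_plus_absorb set_plus_mono)
  qed
qed

lemma coset_mult_scale_one_plus:
  assumes E: "E \<in> convex_subgroups" and one: "1 \<notin> E" and E': "E' \<in> convex_subgroups"
  shows "coset_mult (a *o (1 +o E)) (b *o (1 +o E')) = (a * b) *o (1 +o (E + E'))"
proof -
  have "E * E' + E' = E'"
    using times_subset_scale_convex_subgroup[OF E E' one] E E'
    by (simp add: convex_subgroups_plus_absorb convex_subgroups_times)
  then have absorb: "E' + E + E * E' = E + E'"
    by (metis add.assoc add.commute)
  have "coset_mult (a *o (1 +o E)) (b *o (1 +o E'))
      = (a * b) +o (a *o (b *o E') + b *o (a *o E) + (a *o E) * (b *o E'))"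
    using E E' by (simp add: set_times_plus_distrib coset_mult_eq convex_subgroups_scale)
  also have "\<dots> = (a * b) *o (1 +o (E' + E + E * E'))"
    by (simp add: set_times_plus_distribs set_times_rearranges mult.commute)
  finally show ?thesis by (simp only: absorb)
qed

definition zeroless :: "'a::linordered_field set set" where
  "zeroless = cosets - magnitudes cosets coset_add"

lemma coset_absorb_iff:
  assumes A: "A \<in> convex_subgroups"
  shows "a +o A = A \<longleftrightarrow> a \<in> A"
proof
  assume "a +o A = A"
  then show "a \<in> A" using set_plus_intro2[OF convex_subgroupsD(1)[OF A], of a] by simp
next
  assume a: "a \<in> A"
  have "x - a \<in> A \<longleftrightarrow> x \<in> A" for x
    using convex_subgroupsD(2,4)[OF A _ a] by (metis diff_add_cancel)
  then show "a +o A = A" by (simp add: set_eq_iff set_minus_plus[symmetric])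
qed

lemma coset_in_zeroless_iff: "A \<in> convex_subgroups \<Longrightarrow> a +o A \<in> zeroless \<longleftrightarrow> a \<notin> A"
  by (simp add: zeroless_def magnitudes_def coset_add.neutral_op_l_coset coset_absorb_iff cosetsI)

lemma zerolessE:
  assumes "\<alpha> \<in> zeroless"
  obtains a A where "A \<in> convex_subgroups" "a \<notin> A" "\<alpha> = a +o A"
proof -
  have "\<alpha> \<in> cosets" using assms by (simp add: zeroless_def)
  then obtain a A where "A \<in> convex_subgroups" "\<alpha> = a +o A" by (rule cosetsE)
  then show thesis using assms that coset_in_zeroless_iff by blast
qed

lemma coset_eq_scale_one_plus:
  "a \<noteq> 0 \<Longrightarrow> a +o A = a *o (1 +o ((1 / a) *o (A :: 'a::field set)))"
  by (simp add: set_times_plus_distrib set_times_rearrange2)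

lemma nonzero_if_notin_convex_subgroup: "A \<in> convex_subgroups \<Longrightarrow> a \<notin> A \<Longrightarrow> a \<noteq> 0"
  using convex_subgroupsD(1) by blast

lemma one_plus_scale_in_convex_unit_groups:
  assumes A: "A \<in> convex_subgroups" and a: "a \<notin> A"
  shows "1 +o ((1 / a) *o A) \<in> convex_unit_groups"
proof (rule convex_unit_groupsI[OF convex_subgroups_scale[OF A]])
  show "1 \<notin> (1 / a) *o A"
    using a nonzero_if_notin_convex_subgroup[OF A a] by (simp add: mem_scale_iff)
qed

lemma zeroless_eq_coset_family: "zeroless = coset_family units_group convex_unit_groups"
proof (intro equalityI subsetI)
  fix \<alpha> :: "'a set" assume "\<alpha> \<in> zeroless"
  then obtain a A where A: "A \<in> convex_subgroups" and a: "a \<notin> A" and \<alpha>: "\<alpha> = a +o A"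
    by (rule zerolessE)
  then show "\<alpha> \<in> coset_family units_group convex_unit_groups"
    using nonzero_if_notin_convex_subgroup[OF A a] one_plus_scale_in_convex_unit_groups[OF A a]
      coset_familyI[of a units_group]
    by (simp add: coset_eq_scale_one_plus[of a A] units_group_simps)
next
  fix \<alpha> :: "'a set" assume "\<alpha> \<in> coset_family units_group convex_unit_groups"
  then obtain a E where "a \<noteq> 0" "E \<in> convex_subgroups" "1 \<notin> E" "\<alpha> = a *o (1 +o E)"
    by (elim coset_familyE convex_unit_groupsE) (simp add: units_group_simps)
  then show "\<alpha> \<in> zeroless"
    by (simp add: set_times_plus_distrib coset_in_zeroless_iff convex_subgroups_scale
        mem_scale_iff)
qed

interpretation coset_mult: coset_operation
  "units_group :: 'a::linordered_field monoid" convex_unit_groups coset_mult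
  rewrites "carrier units_group = UNIV - {0 :: 'a}"
    and "l_coset units_group = ((*o) :: 'a \<Rightarrow> _)"
    and "coset_family units_group convex_unit_groups = (zeroless :: 'a set set)"
proof -
  show "coset_operation units_group convex_unit_groups (coset_mult :: 'a set \<Rightarrow> _)"
  proof (intro coset_operation.intro coset_operation_axioms.intro)
    show "comm_group (units_group :: 'a monoid)" by (rule comm_group_units_group)
    show "convex_unit_groups \<noteq> ({} :: 'a set set)"
      using convex_unit_groupsI[OF zero_convex_subgroup] by auto
    fix a b :: 'a and U V :: "'a set"
    assume "U \<in> convex_unit_groups" "V \<in> convex_unit_groups"
    then show "coset_mult (a <#\<^bsub>units_group\<^esub> U) (b <#\<^bsub>units_group\<^esub> V)
        = (a \<otimes>\<^bsub>units_group\<^esub> b) <#\<^bsub>units_group\<^esub> (U <#>\<^bsub>units_group\<^esub> V)"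
      by (elim convex_unit_groupsE)
        (simp add: units_group_simps coset_mult_scale_one_plus one_plus_times_one_plus)
  qed (simp_all add: subgroup_convex_unit_group convex_unit_groups_linear)
qed (simp_all add: units_group_simps zeroless_eq_coset_family)

lemma neutral_op_zeroless_coset:
  assumes "A \<in> convex_subgroups" "a \<notin> A"
  shows "neutral_op zeroless coset_mult (a +o A) = 1 +o ((1 / a) *o A)"
  using nonzero_if_notin_convex_subgroup[OF assms] one_plus_scale_in_convex_unit_groups[OF assms]
  by (simp add: coset_eq_scale_one_plus[of a A] coset_mult.neutral_op_l_coset)

lemma symmetric_op_zeroless_coset:
  assumes "A \<in> convex_subgroups" "a \<notin> A"
  shows "symmetric_op zeroless coset_mult (a +o A) = (1 / a) +o ((1 / a\<^sup>2) *o A)"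
proof -
  have "symmetric_op zeroless coset_mult (a +o A) = (1 / a) *o (1 +o ((1 / a) *o A))"
    using nonzero_if_notin_convex_subgroup[OF assms] one_plus_scale_in_convex_unit_groups[OF assms]
    by (simp add: coset_eq_scale_one_plus[of a A] coset_mult.symmetric_op_l_coset
        m_inv_units_group inverse_eq_divide)
  then show ?thesis
    by (simp add: set_times_plus_distrib set_times_rearrange2 power2_eq_square)
qed

section \<open>The association of cosets\<close>

abbreviation magnitude_of :: "'a::linordered_field set \<Rightarrow> 'a set" where
  "magnitude_of \<equiv> neutral_op cosets coset_add"

lemma magnitude_of_convex_subgroup: "A \<in> convex_subgroups \<Longrightarrow> magnitude_of A = A"
  using coset_add.neutral_op_l_coset[of 0 A] by simp

lemma coset_mult_closed: "\<alpha> \<in> cosets \<Longrightarrow> \<beta> \<in> cosets \<Longrightarrow> coset_mult \<alpha> \<beta> \<in> cosets"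
  by (elim cosetsE) (simp add: coset_mult_eq cosetsI convex_subgroups_closed)

lemma coset_mult_convex_subgroup:
  assumes "A \<in> convex_subgroups" "B \<in> convex_subgroups"
  shows "coset_mult A (b +o B) = b *o A + A * B"
  using coset_mult_eq[OF assms, of 0 b] convex_subgroups_nonempty[OF assms(2)]
  by (simp add: zero_scale)

lemma coset_add_convex_subgroup:
  assumes "A \<in> convex_subgroups" "B \<in> convex_subgroups"
  shows "coset_add (a +o A) B = a +o (A + B)"
  using coset_add_eq[OF assms, of a 0] by simp

lemma coset_mult_distrib:
  assumes A: "A \<in> convex_subgroups" and B: "B \<in> convex_subgroups" and C: "C \<in> convex_subgroups"
  shows "coset_add (coset_mult (a +o A) (b +o B)) (coset_mult (a +o A) (c +o C)) =
    coset_add (coset_add (coset_mult (a +o A) (coset_add (b +o B) (c +o C)))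
      (coset_mult A (b +o B))) (coset_mult A (c +o C))"
proof -
  \<comment> \<open>\<open>(b + c) A\<close> may be strictly smaller than \<open>b A + c A\<close>; the terms \<open>e(x) y + e(x) z\<close> make up for it.\<close>
  have absorb: "(b + c) *o A + (b *o A + c *o A) = b *o A + c *o A"
    using A scale_add_subset[of b c A]
    by (simp add: convex_subgroups_plus_absorb convex_subgroups_closed)
  have "(a *o B + b *o A + A * B) + (a *o C + c *o A + A * C)
      = a *o B + a *o C + (b *o A + c *o A) + (A * B + A * C)"
    by (simp add: ac_simps)
  also have "\<dots> = a *o B + a *o C + ((b + c) *o A + (b *o A + c *o A))
      + ((A * B + A * C) + (A * B + A * C))"
    using A B C by (simp add: absorb convex_subgroups_plus_idem convex_subgroups_closed)
  also have "\<dots> = a *o (B + C) + (b + c) *o A + A * (B + C) + (b *o A + A * B) + (c *o A + A * C)"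
    using A B C
    by (simp add: set_times_plus_distrib2 times_plus_distrib_convex_subgroups ac_simps)
  finally show ?thesis
    using A B C
    by (simp add: coset_mult_eq coset_add_eq coset_mult_convex_subgroup coset_add_convex_subgroup
        convex_subgroups_closed distrib_left)
qed

lemma magnitude_of_coset_mult:
  assumes A: "A \<in> convex_subgroups" and B: "B \<in> convex_subgroups"
  shows "magnitude_of (coset_mult (a +o A) (b +o B)) =
    coset_add (coset_mult A (b +o B)) (coset_mult B (a +o A))"
proof -
  have "coset_add (coset_mult A (b +o B)) (coset_mult B (a +o A))
      = (b *o A + A * B) + (a *o B + B * A)"
    using coset_add_convex_subgroup[of "b *o A + A * B" "a *o B + B * A" 0] A B
    by (simp add: coset_mult_convex_subgroup convex_subgroups_closed)
  also have "\<dots> = a *o B + b *o A + (A * B + A * B)" by (simp add: ac_simps)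
  also have "\<dots> = a *o B + b *o A + A * B"
    using A B by (simp add: convex_subgroups_plus_idem convex_subgroups_closed)
  finally show ?thesis
    using A B
    by (simp add: coset_mult_eq coset_add.neutral_op_l_coset convex_subgroups_closed)
qed

lemma magnitude_of_neutral_op_zeroless_coset:
  assumes A: "A \<in> convex_subgroups" and a: "a \<notin> A"
  shows "magnitude_of (neutral_op zeroless coset_mult (a +o A)) =
    coset_mult A (symmetric_op zeroless coset_mult (a +o A))"
proof -
  have "a \<noteq> 0" by (rule nonzero_if_notin_convex_subgroup[OF A a])
  have "(1 / a\<^sup>2) *o (A * A) \<subseteq> (1 / a\<^sup>2) *o (a *o A)"
    by (rule set_times_mono[OF times_subset_scale_convex_subgroup[OF A A a]])
  also have "\<dots> = (1 / a) *o A"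
    using \<open>a \<noteq> 0\<close> by (simp add: set_times_rearrange2 power2_eq_square)
  finally have "(1 / a) *o A + A * ((1 / a\<^sup>2) *o A) = (1 / a) *o A"
    using A by (simp add: set_times_rearrange4 convex_subgroups_plus_absorb convex_subgroups_closed)
  then show ?thesis
    using A a by (simp add: neutral_op_zeroless_coset symmetric_op_zeroless_coset
        coset_mult_convex_subgroup coset_add.neutral_op_l_coset convex_subgroups_scale)
qed

theorem association_cosets:
  "association (cosets :: 'a::linordered_field set set) coset_add coset_mult"
  unfolding association_def Let_def zeroless_def[symmetric]
proof (intro conjI ballI impI)
  show "assembly (cosets :: 'a set set) coset_add" by (rule coset_add.assembly_coset_family)
  show "assembly (zeroless :: 'a set set) coset_mult" by (rule coset_mult.assembly_coset_family)
  fix \<alpha> :: "'a set" assume \<alpha>: "\<alpha> \<in> cosets"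
  then obtain a A where A: "A \<in> convex_subgroups" "\<alpha> = a +o A" by (elim cosetsE)
  show "magnitude_of (neutral_op zeroless coset_mult \<alpha>) =
      coset_mult (magnitude_of \<alpha>) (symmetric_op zeroless coset_mult \<alpha>)"
    if "\<alpha> \<noteq> magnitude_of \<alpha>"
    using that A magnitude_of_neutral_op_zeroless_coset
    by (simp add: coset_add.neutral_op_l_coset coset_absorb_iff)
  fix \<beta> :: "'a set" assume \<beta>: "\<beta> \<in> cosets"
  then obtain b B where B: "B \<in> convex_subgroups" "\<beta> = b +o B" by (elim cosetsE)
  show "coset_mult \<alpha> \<beta> \<in> cosets" by (rule coset_mult_closed[OF \<alpha> \<beta>])
  have "b *o A + A * B \<in> convex_subgroups" using A B by (simp add: convex_subgroups_closed)
  then show "\<exists>\<gamma>\<in>cosets. coset_mult (magnitude_of \<alpha>) \<beta> = magnitude_of \<gamma>"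
    using A B
    by (intro bexI[of _ "b *o A + A * B"])
      (simp_all add: coset_add.neutral_op_l_coset coset_mult_convex_subgroup
        magnitude_of_convex_subgroup coset_add.subgroup_in_coset_family)
  show "magnitude_of (coset_mult \<alpha> \<beta>) =
      coset_add (coset_mult (magnitude_of \<alpha>) \<beta>) (coset_mult (magnitude_of \<beta>) \<alpha>)"
    using A B by (simp add: coset_add.neutral_op_l_coset magnitude_of_coset_mult)
  show "symmetric_op cosets coset_add (coset_mult \<alpha> \<beta>) =
      coset_mult (symmetric_op cosets coset_add \<alpha>) \<beta>"
    using A B by (simp add: coset_add.symmetric_op_l_coset coset_mult_eq convex_subgroups_closed
        scale_minus_convex_subgroup)
  fix \<gamma> :: "'a set" assume "\<gamma> \<in> cosets"
  then obtain c C where "C \<in> convex_subgroups" "\<gamma> = c +o C" by (elim cosetsE)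
  then show "coset_add (coset_mult \<alpha> \<beta>) (coset_mult \<alpha> \<gamma>) =
      coset_add (coset_add (coset_mult \<alpha> (coset_add \<beta> \<gamma>)) (coset_mult (magnitude_of \<alpha>) \<beta>))
        (coset_mult (magnitude_of \<alpha>) \<gamma>)"
    using A B coset_mult_distrib by (simp add: coset_add.neutral_op_l_coset)
qed

theorem theorem4p6:
  assumes nonarch: "\<not> (\<forall>x::'a::linordered_field. \<exists>n::nat. x \<le> of_nat n)"
  shows "let Q = (cosets :: 'a set set);
             e = neutral_op Q coset_add;
             s = symmetric_op Q coset_add;
             Z = Q - magnitudes Q coset_add;
             u = neutral_op Z coset_mult;
             d = symmetric_op Z coset_mult
    in association Q coset_add coset_mult \<and>
       (\<forall>a. \<forall>A\<in>convex_subgroups.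
          e (a +o A) = A \<and>
          s (a +o A) = (- a) +o A \<and>
          (a +o A \<notin> convex_subgroups \<longrightarrow>
             u (a +o A) = 1 +o ((\<lambda>x. x / a) ` A) \<and>
             d (a +o A) = (1 / a) +o ((\<lambda>x. x / a\<^sup>2) ` A)))"
proof -
  have image_divide: "(\<lambda>x. x / b) ` A = (1 / b) *o A" for b :: 'a and A
    by (auto simp: elt_set_times_def)
  have "a \<notin> A" if "A \<in> convex_subgroups" "a +o A \<notin> convex_subgroups" for a :: 'a and A
    using that by (metis coset_absorb_iff)
  then show ?thesis
    unfolding Let_def zeroless_def[symmetric] image_divide
    by (simp add: association_cosets coset_add.neutral_op_l_coset coset_add.symmetric_op_l_coset
        neutral_op_zeroless_coset symmetric_op_zeroless_coset)
qed

end
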